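(* Every one-dimensional integral domain satisfies property (+).
   Context: Dimension means Krull dimension. A commutative ring $D$ with identity satisfies property (+) if for all $r\in D$ and $a\in D\setminus\{0\}$ there exists $d\in D$ such that $d$ is in every maximal ideal of $D$ that contains $a$ but not $r$, and $d$ is in no maximal ideal of $D$ that contains $r$. *)

theory Defs
  imports "HOL-Algebra.Ideal" "HOL-Library.Extended_Nat"
begin

text \<open>The supremum of the lengths \<open>n\<close> of chains \<open>P 0 \<subset> P 1 \<subset> \<dots> \<subset> P n\<close> of prime ideals.
  The zero ring has no prime ideals and receives the value \<open>Sup {} = 0\<close> here.\<close>

definition krull_dim :: "('a, 'b) ring_scheme \<Rightarrow> enat" where
  "krull_dim D = Sup {enat n |n. \<exists>P. (\<forall>i\<le>n. primeideal (P i) D) \<and> (\<forall>i<n. P i \<subset> P (Suc i))}"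

definition property_plus :: "('a, 'b) ring_scheme \<Rightarrow> bool" where
  "property_plus D \<longleftrightarrow>
     (\<forall>r\<in>carrier D. \<forall>a\<in>carrier D - {\<zero>\<^bsub>D\<^esub>}. \<exists>d\<in>carrier D.
        (\<forall>M. maximalideal M D \<and> a \<in> M \<and> r \<notin> M \<longrightarrow> d \<in> M) \<and>
        (\<forall>M. maximalideal M D \<and> r \<in> M \<longrightarrow> d \<notin> M))"

end

theory Submission
  imports Defs "HOL-Algebra.Ring_Divisibility"
begin

text \<open>For a nonzero \<open>a\<close> the ring \<open>D/aD\<close> has dimension zero, so that \<open>r\<close> is \<open>\<pi>\<close>-regular in it:
  \<open>r^n (1 - r s) \<in> aD\<close> for some \<open>n\<close> and \<open>s\<close>. Then \<open>d = 1 - r s\<close> witnesses property (+).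
  Such \<open>n\<close> and \<open>s\<close> exist, since otherwise a prime \<open>P \<supseteq> aD\<close> avoids the multiplicative set
  of all \<open>r^n (1 - r s)\<close>; then \<open>r \<notin> P\<close> and \<open>P + rD\<close> is proper, so it lies in a prime \<open>Q\<close>, and
  \<open>0 \<subset> P \<subset> Q\<close> contradicts dimension one.\<close>

text \<open>Enlarging an ideal by one element serves twice: to exploit maximality in the Zorn
  argument, and to pass from a prime to a strictly larger one.\<close>

lemma (in cring) ideal_adjoin:
  assumes "ideal I R" "x \<in> carrier R"
  shows "ideal (I <+> PIdl x) R" "I \<subseteq> I <+> PIdl x" "x \<in> I <+> PIdl x"
    and "\<And>y::'a. y \<in> I <+> PIdl x \<Longrightarrow> \<exists>i\<in>I. \<exists>c\<in>carrier R. y = i \<oplus> c \<otimes> x"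
proof -
  interpret I: ideal I R by fact
  show "ideal (I <+> PIdl x) R"
    using assms by (intro add_ideals cgenideal_ideal)
  have "\<zero> = \<zero> \<otimes> x" "x = \<one> \<otimes> x"
    using assms(2) by simp_all
  then have zx: "\<zero> \<in> PIdl x" "x \<in> PIdl x"
    unfolding cgenideal_def by blast+
  show "I \<subseteq> I <+> PIdl x"
  proof
    fix i assume "i \<in> I"
    then have "i = i \<oplus> \<zero>" by (simp add: I.Icarr)
    with \<open>i \<in> I\<close> zx show "i \<in> I <+> PIdl x"
      unfolding set_add_def' by blast
  qed
  have "x = \<zero> \<oplus> x" using assms(2) by simp
  with zx show "x \<in> I <+> PIdl x"
    unfolding set_add_def' using I.zero_closed by blast
  show "\<exists>i\<in>I. \<exists>c\<in>carrier R. y = i \<oplus> c \<otimes> x" if "y \<in> I <+> PIdl x" for y :: 'a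
    using that unfolding set_add_def' cgenideal_def by blast
qed

text \<open>By Zorn some \<open>P\<close> is maximal among the ideals that contain \<open>I\<close>
  and miss \<open>S\<close>. Adjoining to it any element outside \<open>P\<close> forces a meeting
  with \<open>S\<close>, and this makes \<open>P\<close> prime.\<close>

lemma (in cring) exists_primeideal_avoiding:
  assumes I: "ideal I R" and disj: "I \<inter> S = {}"
    and S: "S \<subseteq> carrier R" "\<one> \<in> S" "\<And>s t. s \<in> S \<Longrightarrow> t \<in> S \<Longrightarrow> s \<otimes> t \<in> S"
  obtains P where "primeideal P R" "I \<subseteq> P" "P \<inter> S = {}"
proof -
  let ?A = "{J. ideal J R \<and> I \<subseteq> J \<and> J \<inter> S = {}}"
  have "\<exists>P\<in>?A. \<forall>J\<in>?A. P \<subseteq> J \<longrightarrow> J = P"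
  proof (rule subset_Zorn_nonempty)
    show "?A \<noteq> {}" using I disj by blast
  next
    fix C assume C: "C \<noteq> {}" "subset.chain ?A C"
    then have "subset.chain {J. ideal J R} C"
      unfolding subset_chain_def by blast
    \<comment> \<open>The empty chain gets the zero ideal as default; since \<open>C\<close> is
      nonempty, the union itself is an ideal.\<close>
    from chain_Union_is_ideal[OF this] C(1) have "ideal (\<Union>C) R" by simp
    with C show "\<Union>C \<in> ?A"
      unfolding subset_chain_def by blast
  qed
  then obtain P where P: "ideal P R" "I \<subseteq> P" "P \<inter> S = {}"
    and max: "\<And>J. ideal J R \<Longrightarrow> P \<subseteq> J \<Longrightarrow> J \<inter> S = {} \<Longrightarrow> J = P"
    by (smt (verit, ccfv_SIG) dual_order.trans mem_Collect_eq)
  interpret P: ideal P R by fact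
  have meets: "\<exists>p\<in>P. \<exists>c\<in>carrier R. p \<oplus> c \<otimes> x \<in> S" if "x \<in> carrier R" "x \<notin> P" for x
  proof -
    note adj = ideal_adjoin[OF P(1) that(1)]
    have "(P <+> PIdl x) \<inter> S \<noteq> {}"
      using max[OF adj(1,2)] adj(3) that(2) by blast
    then show ?thesis using adj(4) by blast
  qed
  have "primeideal P R"
  proof (rule primeidealI[OF P(1) is_cring])
    show "carrier R \<noteq> P" using P(3) S(1,2) by blast
  next
    fix a b assume a: "a \<in> carrier R" and b: "b \<in> carrier R" and ab: "a \<otimes> b \<in> P"
    show "a \<in> P \<or> b \<in> P"
    proof (rule ccontr)
      assume "\<not> (a \<in> P \<or> b \<in> P)"
      then obtain p c q e where p: "p \<in> P" "c \<in> carrier R" "p \<oplus> c \<otimes> a \<in> S"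
        and q: "q \<in> P" "e \<in> carrier R" "q \<oplus> e \<otimes> b \<in> S"
        using meets a b by meson
      have pc: "p \<in> carrier R" "q \<in> carrier R" using p q P.Icarr by auto
      \<comment> \<open>Each summand of the expansion has a factor \<open>p\<close>,
        \<open>q\<close> or \<open>a \<otimes> b\<close>, all of which lie in
        \<open>P\<close>.\<close>
      have "(p \<oplus> c \<otimes> a) \<otimes> (q \<oplus> e \<otimes> b)
          = p \<otimes> (q \<oplus> e \<otimes> b) \<oplus> (q \<otimes> (c \<otimes> a) \<oplus> (a \<otimes> b) \<otimes> (c \<otimes> e))"
        using a b p(2) q(2) pc by algebra
      also have "\<dots> \<in> P"
        using p(1,2) q(1,2) a b pc ab by (simp add: P.I_r_closed)
      finally show False using S(3)[OF p(3) q(3)] P(3) by blast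
    qed
  qed
  with P that show thesis by blast
qed

lemma (in cring) exists_primeideal_above:
  assumes "ideal I R" "\<one> \<notin> I"
  obtains P where "primeideal P R" "I \<subseteq> P"
  using exists_primeideal_avoiding[of I "{\<one>}"] assms by auto

lemma no_primeideal_chain_if_krull_dim_le_1:
  assumes "krull_dim R \<le> 1" "primeideal P0 R" "primeideal P1 R" "primeideal P2 R"
    and "P0 \<subset> P1" "P1 \<subset> P2"
  shows False
proof -
  \<comment> \<open>Length counts inclusions, so three primes form a chain of length 2; the values
    beyond index 2 are only padding.\<close>
  let ?P = "\<lambda>i::nat. if i = 0 then P0 else if i = 1 then P1 else P2"
  have "(\<forall>i\<le>2. primeideal (?P i) R) \<and> (\<forall>i<2. ?P i \<subset> ?P (Suc i))"
    using assms(2-) by (auto simp: less_2_cases_iff)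
  then have "enat 2 \<le> krull_dim R"
    unfolding krull_dim_def by (intro Sup_upper CollectI exI[of _ 2] exI[of _ ?P] conjI refl) auto
  also note assms(1)
  finally show False by (simp add: one_enat_def)
qed

lemma (in "domain") pi_regular_mod_if_krull_dim_le_1:
  assumes dim: "krull_dim R \<le> 1" and r: "r \<in> carrier R" and a: "a \<in> carrier R" "a \<noteq> \<zero>"
  obtains n :: nat and s where "s \<in> carrier R" "r [^] n \<otimes> (\<one> \<ominus> r \<otimes> s) \<in> PIdl a"
proof (rule ccontr)
  let ?S = "{r [^] n \<otimes> (\<one> \<ominus> r \<otimes> s) | (n::nat) s. s \<in> carrier R}"
  assume "\<not> thesis"
  with that have disj: "PIdl a \<inter> ?S = {}" by blast
  have memS: "r [^] n \<otimes> (\<one> \<ominus> r \<otimes> s) \<in> ?S" if "s \<in> carrier R" for n :: nat and s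
    using that by blast
  have "?S \<subseteq> carrier R" using r by auto
  moreover have "\<one> \<in> ?S"
  proof -
    have "r [^] (0::nat) \<otimes> (\<one> \<ominus> r \<otimes> \<zero>) = \<one>" using r by (simp add: minus_eq)
    with memS[of \<zero> 0] show ?thesis by simp
  qed
  moreover have "x \<otimes> y \<in> ?S" if xy: "x \<in> ?S" "y \<in> ?S" for x y
  proof -
    from xy obtain m n :: nat and s t where s: "s \<in> carrier R" "x = r [^] m \<otimes> (\<one> \<ominus> r \<otimes> s)"
      and t: "t \<in> carrier R" "y = r [^] n \<otimes> (\<one> \<ominus> r \<otimes> t)"
      by blast
    \<comment> \<open>This \<open>u\<close> is chosen so that
      \<open>(1 - r s)(1 - r t) = 1 - r u\<close>.\<close>
    define u where "u = s \<oplus> t \<ominus> r \<otimes> s \<otimes> t"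
    define rm rn where "rm = r [^] m" and "rn = r [^] n"
    have rmn: "rm \<in> carrier R" "rn \<in> carrier R" using r by (auto simp: rm_def rn_def)
    have u: "u \<in> carrier R" using r s t by (simp add: u_def)
    have "x \<otimes> y = (rm \<otimes> rn) \<otimes> (\<one> \<ominus> r \<otimes> u)"
      unfolding s(2) t(2) u_def rm_def[symmetric] rn_def[symmetric]
      using r s(1) t(1) rmn by algebra
    also have "rm \<otimes> rn = r [^] (m + n)" using r by (simp add: nat_pow_mult rm_def rn_def)
    finally show ?thesis using memS[OF u] by simp
  qed
  ultimately obtain P where P: "primeideal P R" "PIdl a \<subseteq> P" "P \<inter> ?S = {}"
    by (rule exists_primeideal_avoiding[OF cgenideal_ideal[OF a(1)] disj])
  interpret P: primeideal P R by fact
  \<comment> \<open>The exponent 1 with \<open>s = 0\<close> puts \<open>r\<close> itself into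
    \<open>?S\<close>, so \<open>P\<close> cannot contain it.\<close>
  have "r [^] (1::nat) \<otimes> (\<one> \<ominus> r \<otimes> \<zero>) = r" using r by (simp add: minus_eq)
  with memS[of \<zero> 1] P(3) have rP: "r \<notin> P" by auto
  note adj = ideal_adjoin[OF P.is_ideal r]
  \<comment> \<open>If \<open>1 = p + c r\<close> with \<open>p\<close> in \<open>P\<close>, then
    \<open>p = 1 - r c\<close> is the element of \<open>?S\<close> with exponent 0, although
    \<open>P\<close> misses \<open>?S\<close>.\<close>
  have "\<one> \<notin> P <+> PIdl r"
  proof
    assume "\<one> \<in> P <+> PIdl r"
    then obtain p c where p: "p \<in> P" "c \<in> carrier R" "\<one> = p \<oplus> c \<otimes> r"
      using adj(4) by blast
    have pc: "p \<in> carrier R" using p(1) P.Icarr by blast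
    then have "p = (p \<oplus> c \<otimes> r) \<ominus> r \<otimes> c"
      using p(2) r by algebra
    then have "p = \<one> \<ominus> r \<otimes> c"
      unfolding p(3)[symmetric] .
    then have "r [^] (0::nat) \<otimes> (\<one> \<ominus> r \<otimes> c) = p"
      using pc by simp
    with memS[OF p(2), of 0] p(1) P(3) show False by auto
  qed
  then obtain Q :: "'a set" where Q: "primeideal Q R" "P <+> PIdl r \<subseteq> Q"
    using exists_primeideal_above adj(1) by blast
  \<comment> \<open>The element \<open>a\<close> makes the inclusion of the zero ideal in
    \<open>P\<close> strict, and \<open>r\<close> makes that of \<open>P\<close> in \<open>Q\<close>
    strict.\<close>
  have "a \<in> P" using P(2) cgenideal_self[OF a(1)] by blast
  then have "{\<zero>} \<subset> P" using a(2) P.zero_closed by blast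
  moreover have "P \<subset> Q" using Q(2) adj(2,3) rP by blast
  ultimately show False
    using no_primeideal_chain_if_krull_dim_le_1[OF dim zeroprimeideal P(1) Q(1)] by blast
qed

theorem proposition2p9:
  fixes D :: "('a, 'b) ring_scheme"
  assumes "domain D"
    and "krull_dim D = 1"
  shows "property_plus D"
proof -
  interpret "domain" D by fact
  show ?thesis
    unfolding property_plus_def
  proof (intro ballI)
    fix r a assume r: "r \<in> carrier D" and a: "a \<in> carrier D - {\<zero>\<^bsub>D\<^esub>}"
    obtain n :: nat and s where s: "s \<in> carrier D"
      and rs: "r [^]\<^bsub>D\<^esub> n \<otimes>\<^bsub>D\<^esub> (\<one>\<^bsub>D\<^esub> \<ominus>\<^bsub>D\<^esub> r \<otimes>\<^bsub>D\<^esub> s) \<in> PIdl\<^bsub>D\<^esub> a"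
      using pi_regular_mod_if_krull_dim_le_1[of r a thesis] assms(2) r a by fastforce
    let ?d = "\<one>\<^bsub>D\<^esub> \<ominus>\<^bsub>D\<^esub> r \<otimes>\<^bsub>D\<^esub> s"
    have d: "?d \<in> carrier D" using r s by simp
    \<comment> \<open>The product of \<open>r^n\<close> and \<open>?d\<close> lies in
      \<open>aD\<close>, hence in the prime ideal \<open>M\<close>, which contains no power of
      \<open>r\<close>.\<close>
    have "?d \<in> M" if M: "maximalideal M D" "a \<in> M" "r \<notin> M" for M
    proof -
      interpret M: primeideal M D using maximalideal_prime[OF M(1)] .
      have "r [^]\<^bsub>D\<^esub> k \<notin> M" for k :: nat
      proof (induction k)
        case 0
        then show ?case using M.one_imp_carrier M.I_notcarr by auto
      next
        case (Suc k)
        then show ?case using M.I_prime[of "r [^]\<^bsub>D\<^esub> k" r] M(3) r by auto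
      qed
      moreover have "PIdl\<^bsub>D\<^esub> a \<subseteq> M"
        using cgenideal_minimal[OF M.is_ideal M(2)] .
      ultimately show ?thesis
        using M.I_prime[of "r [^]\<^bsub>D\<^esub> n" ?d] rs r d by auto
    qed
    \<comment> \<open>An ideal containing both \<open>r\<close> and \<open>?d\<close> would contain
      \<open>?d + r s = 1\<close>.\<close>
    moreover have "?d \<notin> M" if M: "maximalideal M D" "r \<in> M" for M
    proof
      assume "?d \<in> M"
      interpret M: maximalideal M D by fact
      have "?d \<oplus>\<^bsub>D\<^esub> r \<otimes>\<^bsub>D\<^esub> s \<in> M"
        using \<open>?d \<in> M\<close> M.I_r_closed[OF M(2) s] by (rule M.a_closed)
      moreover have "?d \<oplus>\<^bsub>D\<^esub> r \<otimes>\<^bsub>D\<^esub> s = \<one>\<^bsub>D\<^esub>"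
        using r s by algebra
      ultimately show False using M.one_imp_carrier M.I_notcarr by auto
    qed
    ultimately show "\<exists>d\<in>carrier D.
        (\<forall>M. maximalideal M D \<and> a \<in> M \<and> r \<notin> M \<longrightarrow> d \<in> M) \<and>
        (\<forall>M. maximalideal M D \<and> r \<in> M \<longrightarrow> d \<notin> M)"
      using d by blast
  qed
qed

end
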